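(* Let $\Phi=(G,\varphi)$ be a $\mathbb{T}$-gain graph and let $\mu(G)$ be the matching number of $G$. Then $\mathcal{E}(\Phi)\geq 2\mu(G)$.
   Context: A $\mathbb{T}$-gain graph $\Phi=(G,\varphi)$ consists of a finite simple graph $G$ and a map $\varphi$ assigning to each orientation $\overrightarrow{e_{p,q}}$ of each edge $v_pv_q$ a value in $\mathbb{T}=\{z\in\mathbb{C}:|z|=1\}$, with $\varphi(\overrightarrow{e_{q,p}})=\varphi(\overrightarrow{e_{p,q}})^{-1}$. Its adjacency matrix $A(\Phi)$ is the Hermitian matrix whose $(p,q)$ entry is $\varphi(\overrightarrow{e_{p,q}})$ if $v_p\sim v_q$ and $0$ otherwise; the energy $\mathcal{E}(\Phi)$ is the sum of absolute values of the eigenvalues of $A(\Phi)$. The matching number $\mu(G)$ is the maximum number of pairwise disjoint edges of $G$. *)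

theory Defs
  imports
    "Graph_Theory.Pair_Digraph"
    "Jordan_Normal_Form.Spectral_Radius"
    "Jordan_Normal_Form.Schur_Decomposition"
    "HOL-Library.Disjoint_Sets"
begin

text \<open>
  A finite simple graph is a \<open>pair_graph\<close>: a finite, symmetric, loop-free set of ordered pairs.
  Each undirected edge is represented by its two orientations, so the gain function lives on
  \<open>parcs G\<close>; its values on other pairs are unconstrained and never used.
\<close>

locale gain_graph = pair_graph G for G :: "'a pair_pre_digraph" +
  fixes \<phi> :: "'a \<times> 'a \<Rightarrow> complex"
  assumes gain_unit: "e \<in> parcs G \<Longrightarrow> cmod (\<phi> e) = 1"
    and gain_reverse: "(u, v) \<in> parcs G \<Longrightarrow> \<phi> (v, u) = inverse (\<phi> (u, v))"

text \<open>
  Matrices are indexed by \<open>{0..<n}\<close>, so the adjacency matrix is taken with respect to a list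
  \<open>vs\<close> enumerating the vertices; \<open>vs ! p\<close> is the vertex with index \<open>p\<close>.
\<close>

definition adjacency_matrix ::
    "'a pair_pre_digraph \<Rightarrow> ('a \<times> 'a \<Rightarrow> complex) \<Rightarrow> 'a list \<Rightarrow> complex mat" where
  "adjacency_matrix G \<phi> vs = mat (length vs) (length vs)
     (\<lambda>(p, q). if (vs ! p, vs ! q) \<in> parcs G then \<phi> (vs ! p, vs ! q) else 0)"

lemma (in gain_graph) adjacency_matrix_hermitian:
  "mat_adjoint (adjacency_matrix G \<phi> vs) = adjacency_matrix G \<phi> vs"
proof (rule eq_matI)
  fix i j
  assume "i < dim_row (adjacency_matrix G \<phi> vs)" "j < dim_col (adjacency_matrix G \<phi> vs)"
  then have ij: "i < length vs" "j < length vs"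
    by (simp_all add: adjacency_matrix_def)
  have sym: "(b, a) \<in> parcs G" if "(a, b) \<in> parcs G" for a b
    using that pair_sym_arcs by (auto simp: symmetric_def dest: symD)
  have cnj: "cnj (\<phi> (b, a)) = \<phi> (a, b)" if "(b, a) \<in> parcs G" for a b
  proof -
    have "\<phi> (b, a) * cnj (\<phi> (b, a)) = 1"
      using gain_unit[OF that] complex_norm_square[of "\<phi> (b, a)"] by simp
    then show ?thesis
      using gain_reverse[OF that] inverse_unique by metis
  qed
  have "mat_adjoint (adjacency_matrix G \<phi> vs) $$ (i, j) = cnj (adjacency_matrix G \<phi> vs $$ (j, i))"
    using ij by (simp add: adjacency_matrix_def mat_adjoint_def mat_of_rows_def)
  also have "\<dots> = adjacency_matrix G \<phi> vs $$ (i, j)"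
    using ij sym[of "vs ! i" "vs ! j"] sym[of "vs ! j" "vs ! i"] cnj[of "vs ! j" "vs ! i"]
    by (simp add: adjacency_matrix_def)
  finally show "mat_adjoint (adjacency_matrix G \<phi> vs) $$ (i, j) = adjacency_matrix G \<phi> vs $$ (i, j)" .
qed (simp_all add: adjacency_matrix_def mat_adjoint_def)

text \<open>
  Eigenvalues are counted with algebraic multiplicity, i.e. their order as roots of the
  characteristic polynomial. As the matrix is Hermitian its eigenvalues are real, so the complex
  modulus below is their absolute value.
\<close>

definition energy ::
    "'a pair_pre_digraph \<Rightarrow> ('a \<times> 'a \<Rightarrow> complex) \<Rightarrow> 'a list \<Rightarrow> real" where
  "energy G \<phi> vs =
     (let A = adjacency_matrix G \<phi> vs
      in \<Sum>ev\<in>spectrum A. real (order ev (char_poly A)) * cmod ev)"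

definition edges :: "'a pair_pre_digraph \<Rightarrow> 'a set set" where
  "edges G = {{u, v} | u v. (u, v) \<in> parcs G}"

definition matchings :: "'a pair_pre_digraph \<Rightarrow> 'a set set set" where
  "matchings G = {M. M \<subseteq> edges G \<and> disjoint M}"

definition matching_number :: "'a pair_pre_digraph \<Rightarrow> nat" where
  "matching_number G = Max (card ` matchings G)"

lemma (in pair_fin_digraph) finite_edges: "finite (edges G)"
proof -
  have "edges G = (\<lambda>(u, v). {u, v}) ` parcs G"
    by (auto simp: edges_def)
  then show ?thesis
    using pair_finite_arcs by simp
qed

lemma (in pair_fin_digraph) finite_matchings: "finite (matchings G)"
  by (rule finite_subset[of _ "Pow (edges G)"]) (auto simp: matchings_def finite_edges)

lemma matchings_nonempty: "matchings G \<noteq> {}"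
  by (auto simp: matchings_def intro: exI[of _ "{}"])

end

theory Submission
  imports Defs
begin

text \<open>
  Diagonalise the Hermitian adjacency matrix \<open>A = U D U\<^sup>*\<close> with \<open>U\<close> unitary, and pair it with the partial
  isometry \<open>N\<close> obtained from \<open>A\<close> by keeping only the entries of a maximum matching. Since the
  kept entries have modulus one, \<open>tr (N\<^sup>* A) = 2 \<mu>\<close>. On the other hand
  \<open>tr (N\<^sup>* A) = \<Sum>\<^sub>k d\<^sub>k \<langle>N u\<^sub>k, u\<^sub>k\<rangle>\<close> over the orthonormal eigenvectors \<open>u\<^sub>k\<close>, and every inner
  product has modulus at most one, because \<open>N\<close> has at most one nonzero entry in each row and column.
\<close>

section \<open>Conjugate transposes and block-diagonal products\<close>

lemma mat_adjoint_dim [simp]: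
  "dim_row (mat_adjoint A) = dim_col A" "dim_col (mat_adjoint A) = dim_row A"
  by (simp_all add: mat_adjoint_def)

lemma mat_adjoint_carrier [simp]:
  "A \<in> carrier_mat n m \<Longrightarrow> mat_adjoint A \<in> carrier_mat m n"
  by (auto intro: carrier_matI)

lemma mat_adjoint_index [simp]:
  fixes A :: "complex mat"
  shows "i < dim_col A \<Longrightarrow> j < dim_row A \<Longrightarrow> mat_adjoint A $$ (i, j) = cnj (A $$ (j, i))"
  by (simp add: mat_adjoint_def mat_of_rows_def)

lemma mat_adjoint_mat_adjoint [simp]:
  fixes A :: "complex mat"
  shows "mat_adjoint (mat_adjoint A) = A"
  by (rule eq_matI) auto

lemma mat_adjoint_mult:
  fixes A B :: "complex mat"
  assumes "A \<in> carrier_mat n m" "B \<in> carrier_mat m k"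
  shows "mat_adjoint (A * B) = mat_adjoint B * mat_adjoint A"
  using assms by (intro eq_matI) (auto simp: scalar_prod_def mult.commute)

lemma mat_adjoint_four_block_diag:
  fixes A D :: "complex mat"
  assumes "A \<in> carrier_mat n n" "D \<in> carrier_mat m m"
  shows "mat_adjoint (four_block_mat A (0\<^sub>m n m) (0\<^sub>m m n) D)
    = four_block_mat (mat_adjoint A) (0\<^sub>m n m) (0\<^sub>m m n) (mat_adjoint D)"
  using assms by (intro eq_matI) auto

lemma mult_four_block_diag:
  assumes "A \<in> carrier_mat n n" "B \<in> carrier_mat n n" "C \<in> carrier_mat m m" "D \<in> carrier_mat m m"
  shows "four_block_mat A (0\<^sub>m n m) (0\<^sub>m m n) C * four_block_mat B (0\<^sub>m n m) (0\<^sub>m m n) D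
    = four_block_mat (A * B) (0\<^sub>m n m) (0\<^sub>m m n) (C * D)"
  using assms by (subst mult_four_block_mat[of _ n n _ m _ m _ _ n _ m]) auto

section \<open>Unitary diagonalisation of Hermitian matrices\<close>

text \<open>Extend \<open>v\<close> to a basis, orthogonalise with Gram-Schmidt and normalise the
  columns. The scalar \<open>c\<close> absorbs the normalisation; it is left open because any
  nonzero multiple of an eigenvector serves equally well.\<close>

lemma unitary_completion:
  fixes v :: "complex vec"
  assumes v: "v \<in> carrier_vec n" and v0: "v \<noteq> 0\<^sub>v n"
  obtains W c where "W \<in> carrier_mat n n" "mat_adjoint W * W = 1\<^sub>m n" "col W 0 = c \<cdot>\<^sub>v v"
proof -
  interpret cof_vec_space n "TYPE(complex)" .
  define b where "b = basis_completion v"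
  note bc = basis_completion[OF v v0, folded b_def]
  have n: "n \<noteq> 0"
    using v v0 by (metis carrier_vecD eq_vecI index_zero_vec(2) less_nat_zero_code)
  obtain vs where bv: "b = v # vs"
    using bc(6,7) n by (cases b) auto
  define ws where "ws = gram_schmidt n b"
  have ws: "corthogonal ws" "set ws \<subseteq> carrier_vec n" "length ws = n"
    using gram_schmidt_result[OF bc(2,4,5) ws_def] bc(6) by auto
  \<comment> \<open>Gram-Schmidt leaves the first vector of its input unchanged.\<close>
  have hd: "ws ! 0 = v"
    using gram_schmidt_hd[OF v, of vs, folded bv] ws(3) n
    by (metis hd_conv_nth length_0_conv ws_def)
  have dim: "dim_vec (ws ! i) = n" if "i < n" for i
    using ws that by (metis carrier_vecD nth_mem subsetD)
  define nrm where "nrm i = (\<Sum>k<n. (cmod (ws ! i $ k))\<^sup>2)" for i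
  \<comment> \<open>The conjugate sits on \<open>ws ! i\<close> so that, up to scaling, this is
    entry \<open>(i, j)\<close> of \<open>mat_adjoint W * W\<close>.\<close>
  have ip: "(\<Sum>k<n. ws ! j $ k * cnj (ws ! i $ k)) = (if i = j then of_real (nrm i) else 0)"
    if "i < n" "j < n" for i j
  proof (cases "i = j")
    case False
    have "ws ! j \<bullet>c ws ! i = 0"
      using ws(1) that False unfolding corthogonal_def ws(3) by auto
    then show ?thesis
      using False dim[OF that(1)] by (simp add: scalar_prod_def atLeast0LessThan)
  qed (simp add: nrm_def flip: complex_norm_square)
  \<comment> \<open>\<open>corthogonal\<close> is an equivalence: inner products vanish exactly for
    distinct indices, so no \<open>ws ! i\<close> is zero and division by its norm is
    legitimate.\<close>
  have nrm_pos: "nrm i > 0" if "i < n" for i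
  proof -
    have "ws ! i \<bullet>c ws ! i \<noteq> 0"
      using ws(1) that unfolding corthogonal_def ws(3) by auto
    then have "nrm i \<noteq> 0"
      using dim[OF that] ip[OF that that] by (simp add: scalar_prod_def atLeast0LessThan)
    moreover have "nrm i \<ge> 0"
      by (simp add: nrm_def sum_nonneg)
    ultimately show ?thesis by simp
  qed
  define W where "W = mat n n (\<lambda>(i, j). ws ! j $ i / complex_of_real (sqrt (nrm j)))"
  have "mat_adjoint W * W = 1\<^sub>m n"
  proof (rule eq_matI)
    fix i j assume "i < dim_row (1\<^sub>m n :: complex mat)" "j < dim_col (1\<^sub>m n :: complex mat)"
    then have ij: "i < n" "j < n" by auto
    have "(mat_adjoint W * W) $$ (i, j)
      = (\<Sum>k<n. ws ! j $ k * cnj (ws ! i $ k) / of_real (sqrt (nrm i) * sqrt (nrm j)))"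
      using ij by (auto simp: W_def scalar_prod_def atLeast0LessThan intro!: sum.cong)
    also have "\<dots> = (\<Sum>k<n. ws ! j $ k * cnj (ws ! i $ k)) / of_real (sqrt (nrm i) * sqrt (nrm j))"
      by (simp add: sum_divide_distrib)
    also have "\<dots> = 1\<^sub>m n $$ (i, j)"
      using ij nrm_pos[of i] by (auto simp: ip simp flip: of_real_mult)
    finally show "(mat_adjoint W * W) $$ (i, j) = 1\<^sub>m n $$ (i, j)" .
  qed (simp_all add: W_def)
  moreover have "col W 0 = (1 / complex_of_real (sqrt (nrm 0))) \<cdot>\<^sub>v v"
    using n v hd by (intro eq_vecI) (auto simp: W_def)
  ultimately show thesis
    using that[of W] by (simp add: W_def)
qed

text \<open>Induction on the dimension: in a unitary basis starting with an eigenvector, the first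
  column is a multiple of the first unit vector, and Hermitian symmetry clears the first row as
  well. What remains is a smaller Hermitian block.\<close>

theorem hermitian_unitarily_diagonalizable:
  fixes A :: "complex mat"
  assumes "A \<in> carrier_mat n n" "mat_adjoint A = A"
  obtains U D where "U \<in> carrier_mat n n" "mat_adjoint U * U = 1\<^sub>m n"
    "D \<in> carrier_mat n n" "diagonal_mat D" "A = U * D * mat_adjoint U"
proof -
  \<comment> \<open>Stated as a conjugation of \<open>A\<close>, because successive unitary
    conjugations compose directly; the factorisation of \<open>A\<close> is recovered at the
    end.\<close>
  have "\<exists>U. U \<in> carrier_mat n n \<and> mat_adjoint U * U = 1\<^sub>m n \<and> diagonal_mat (mat_adjoint U * A * U)"
    using assms
  proof (induction n arbitrary: A)
    case 0
    then show ?case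
      by (intro exI[of _ "1\<^sub>m 0"]) (auto simp: diagonal_mat_def)
  next
    case (Suc n)
    note A = Suc.prems(1) and herm = Suc.prems(2)
    obtain ev where "eigenvalue A ev"
      using spectrum_non_empty[OF A] by (auto simp: spectrum_def)
    then obtain v where v: "v \<in> carrier_vec (Suc n)" "v \<noteq> 0\<^sub>v (Suc n)" "A *\<^sub>v v = ev \<cdot>\<^sub>v v"
      using A by (auto simp: eigenvalue_def eigenvector_def)
    obtain W c where W: "W \<in> carrier_mat (Suc n) (Suc n)" "mat_adjoint W * W = 1\<^sub>m (Suc n)"
      and c: "col W 0 = c \<cdot>\<^sub>v v"
      using unitary_completion[OF v(1,2)] .
    note [simp] = assoc_mult_mat[of _ "Suc n" "Suc n" _ "Suc n" _ "Suc n"]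
    have W': "mat_adjoint W \<in> carrier_mat (Suc n) (Suc n)"
      using W by simp
    define A' where "A' = mat_adjoint W * A * W"
    have A': "A' \<in> carrier_mat (Suc n) (Suc n)"
      using A W W' by (auto simp: A'_def)
    have herm': "mat_adjoint A' = A'"
      using A W W' herm by (simp add: A'_def mat_adjoint_mult[of _ "Suc n" "Suc n" _ "Suc n"])
    have Av: "A *\<^sub>v col W 0 = ev \<cdot>\<^sub>v col W 0"
      using v A by (simp add: c smult_smult_assoc mult.commute mult_mat_vec)
    have "A' = mat_adjoint W * (A * W)"
      using A W W' by (simp add: A'_def)
    \<comment> \<open>With \<open>w\<close> the first column of \<open>W\<close>, this column is
      \<open>W* A w = ev W* w\<close>, and \<open>W* w\<close> is the first column of the
      identity.\<close>
    then have "col A' 0 = mat_adjoint W *\<^sub>v (A *\<^sub>v col W 0)"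
      by (simp only: col_mult2[OF W' mult_carrier_mat[OF A W(1)]] col_mult2[OF A W(1)] zero_less_Suc)
    also have "\<dots> = ev \<cdot>\<^sub>v (mat_adjoint W *\<^sub>v col W 0)"
      using W(1) by (simp add: Av mult_mat_vec[OF W'] carrier_vecI)
    also have "mat_adjoint W *\<^sub>v col W 0 = col (mat_adjoint W * W) 0"
      by (simp only: col_mult2[OF W' W(1)] zero_less_Suc)
    finally have col0: "col A' 0 = ev \<cdot>\<^sub>v unit_vec (Suc n) 0"
      unfolding W(2) by simp
    have first_col: "A' $$ (i, 0) = 0" if "i < Suc n" "i \<noteq> 0" for i
      using arg_cong[OF col0, of "\<lambda>u. u $ i"] that A' by auto
    have first_row: "A' $$ (0, i) = 0" if "i < Suc n" "i \<noteq> 0" for i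
      using first_col[OF that] arg_cong[OF herm', of "\<lambda>M. M $$ (0, i)"] that A' by simp
    define B where "B = mat n n (\<lambda>(i, j). A' $$ (Suc i, Suc j))"
    define E where "E = mat 1 1 (\<lambda>_. A' $$ (0, 0))"
    have B: "B \<in> carrier_mat n n" and E: "E \<in> carrier_mat 1 1"
      by (simp_all add: B_def E_def)
    have block: "A' = four_block_mat E (0\<^sub>m 1 n) (0\<^sub>m n 1) B"
    proof (rule eq_matI)
      fix i j
      assume "i < dim_row (four_block_mat E (0\<^sub>m 1 n) (0\<^sub>m n 1) B)"
        "j < dim_col (four_block_mat E (0\<^sub>m 1 n) (0\<^sub>m n 1) B)"
      then have "i < Suc n" "j < Suc n" by (auto simp: E_def B_def)
      then show "A' $$ (i, j) = four_block_mat E (0\<^sub>m 1 n) (0\<^sub>m n 1) B $$ (i, j)"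
        using first_row[of j] first_col[of i] by (cases i; cases j) (auto simp: E_def B_def)
    qed (use A' in \<open>auto simp: E_def B_def\<close>)
    have "mat_adjoint B = B"
    proof (rule eq_matI)
      fix i j assume "i < dim_row B" "j < dim_col B"
      then have ij: "i < n" "j < n" by (auto simp: B_def)
      then have "cnj (A' $$ (Suc j, Suc i)) = A' $$ (Suc i, Suc j)"
        using arg_cong[OF herm', of "\<lambda>M. M $$ (Suc i, Suc j)"] A' by simp
      then show "mat_adjoint B $$ (i, j) = B $$ (i, j)"
        using ij by (simp add: B_def)
    qed (simp_all add: B_def)
    then obtain V where V: "V \<in> carrier_mat n n" "mat_adjoint V * V = 1\<^sub>m n"
      and diag: "diagonal_mat (mat_adjoint V * B * V)"
      using Suc.IH[OF B] by blast
    \<comment> \<open>\<open>V\<close> is extended by the identity on the first coordinate, so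
      conjugating by \<open>V1\<close> keeps the corner \<open>E\<close> and diagonalises
      \<open>B\<close>.\<close>
    define V1 where "V1 = four_block_mat (1\<^sub>m 1) (0\<^sub>m 1 n) (0\<^sub>m n 1) V"
    have V1: "V1 \<in> carrier_mat (Suc n) (Suc n)"
      using four_block_carrier_mat[OF one_carrier_mat[of 1] V(1)] by (simp add: V1_def)
    have V1': "mat_adjoint V1 \<in> carrier_mat (Suc n) (Suc n)"
      using V1 by simp
    have adj: "mat_adjoint V1 = four_block_mat (1\<^sub>m 1) (0\<^sub>m 1 n) (0\<^sub>m n 1) (mat_adjoint V)"
      unfolding V1_def by (subst mat_adjoint_four_block_diag) (use V in auto)
    have "mat_adjoint V1 * V1 = 1\<^sub>m (Suc n)"
      unfolding adj unfolding V1_def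
      using V by (simp add: mult_four_block_diag)
    then have unitary: "mat_adjoint (W * V1) * (W * V1) = 1\<^sub>m (Suc n)"
      using W W' V1 V1'
      by (simp add: mat_adjoint_mult[of _ "Suc n" "Suc n" _ "Suc n"]
          flip: assoc_mult_mat[of "mat_adjoint W" "Suc n" "Suc n" W "Suc n" V1 "Suc n"])
    have "mat_adjoint (W * V1) * A * (W * V1) = mat_adjoint V1 * A' * V1"
      using W W' V1 V1' A by (simp add: mult_carrier_mat[of _ "Suc n" "Suc n" _ "Suc n"] A'_def mat_adjoint_mult[of _ "Suc n" "Suc n" _ "Suc n"])
    also have "\<dots> = four_block_mat E (0\<^sub>m 1 n) (0\<^sub>m n 1) (mat_adjoint V * B * V)"
      unfolding adj unfolding block V1_def
      using V B E by (simp add: mult_four_block_diag mult_carrier_mat[of _ n n _ n])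
    also have "diagonal_mat \<dots>"
      using diag V B unfolding diagonal_mat_def by (auto simp: E_def)
    finally show ?case
      using W V1 unitary by (intro exI[of _ "W * V1"]) auto
  qed
  then obtain U where U: "U \<in> carrier_mat n n" "mat_adjoint U * U = 1\<^sub>m n"
    and diag: "diagonal_mat (mat_adjoint U * A * U)" by blast
  note [simp] = assoc_mult_mat[of _ n n _ n _ n]
  have U': "mat_adjoint U \<in> carrier_mat n n" using U by simp
  \<comment> \<open>For square matrices a left inverse is also a right inverse.\<close>
  have UU': "U * mat_adjoint U = 1\<^sub>m n"
    using mat_mult_left_right_inverse[OF U' U(1) U(2)] .
  have "U * (mat_adjoint U * A * U) * mat_adjoint U = (U * mat_adjoint U) * A * (U * mat_adjoint U)"
    using U(1) U' assms(1) by (simp add: mult_carrier_mat[of _ n n _ n])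
  then have "A = U * (mat_adjoint U * A * U) * mat_adjoint U"
    using assms(1) by (simp add: UU')
  then show thesis
    using that[OF U _ diag] U(1) U' assms(1) by auto
qed

section \<open>Root multiplicities and sums over eigenvalues\<close>

lemma order_prod_list_linear:
  fixes xs :: "'b::field list"
  shows "order x (\<Prod>a\<leftarrow>xs. [:- a, 1:]) = count_list xs x"
proof (induction xs)
  case (Cons a xs)
  have "(\<Prod>a\<leftarrow>xs. [:- a, 1:]) \<noteq> 0"
    by (auto simp: prod_list_zero_iff)
  then have "order x ([:- a, 1:] * (\<Prod>a\<leftarrow>xs. [:- a, 1:]))
    = order x [:- a, 1:] + order x (\<Prod>a\<leftarrow>xs. [:- a, 1:])"
    by (intro order_mult) (simp del: mult_pCons_left)
  moreover have "order x [:- a, 1:] = (if a = x then 1 else 0)"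
    using order_power_n_n[of x 1] by (auto intro: order_0I)
  ultimately show ?case
    using Cons by (simp del: mult_pCons_left)
qed simp

text \<open>Lets the energy be read off a diagonal form: repetitions in the list of roots are
  exactly the algebraic multiplicities.\<close>

lemma sum_spectrum_order:
  fixes f :: "complex \<Rightarrow> real"
  assumes A: "A \<in> carrier_mat n n" and cp: "char_poly A = (\<Prod>a\<leftarrow>as. [:- a, 1:])"
  shows "(\<Sum>ev\<in>spectrum A. real (order ev (char_poly A)) * f ev) = (\<Sum>a\<leftarrow>as. f a)"
proof -
  have "spectrum A = set as"
    unfolding spectrum_def eigenvalue_root_char_poly[OF A, symmetric] cp
    by (auto simp: poly_prod_list o_def prod_list_zero_iff eigenvalue_root_char_poly[OF A] cp)
  moreover have "(\<Sum>ev\<in>set as. real (count_list as ev) * f ev) = (\<Sum>a\<leftarrow>as. f a)"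
  proof (induction as)
    case (Cons a as)
    have "(\<Sum>ev\<in>set (a # as). real (count_list (a # as) ev) * f ev)
      = (\<Sum>ev\<in>set (a # as). (if ev = a then f ev else 0) + real (count_list as ev) * f ev)"
      by (intro sum.cong) (auto simp: algebra_simps)
    also have "\<dots> = f a + (\<Sum>ev\<in>set (a # as). real (count_list as ev) * f ev)"
      by (simp add: sum.distrib)
    \<comment> \<open>If \<open>a\<close> is new, its count in \<open>as\<close> is 0, so its term
      vanishes.\<close>
    also have "(\<Sum>ev\<in>set (a # as). real (count_list as ev) * f ev) = (\<Sum>ev\<in>set as. real (count_list as ev) * f ev)"
      by (rule sum.mono_neutral_right) (auto simp: count_notin)
    finally show ?case using Cons by simp
  qed simp
  ultimately show ?thesis
    by (simp add: cp order_prod_list_linear)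
qed

section \<open>Entries in distinct rows and columns against the energy\<close>

text \<open>Injectivity of both projections means that \<open>S\<close> has at most one position in
  each row and each column. Phases supported on such a set form a contraction, whose quadratic form
  at a unit eigenvector has modulus at most one.\<close>

lemma sum_le_energy:
  fixes A :: "complex mat"
  assumes A: "A \<in> carrier_mat n n" and herm: "mat_adjoint A = A"
    and S: "S \<subseteq> {..<n} \<times> {..<n}" and inj: "inj_on fst S" "inj_on snd S"
  shows "(\<Sum>(p, q)\<in>S. cmod (A $$ (p, q))) \<le> (\<Sum>ev\<in>spectrum A. real (order ev (char_poly A)) * cmod ev)"
proof -
  obtain U D where U: "U \<in> carrier_mat n n" "mat_adjoint U * U = 1\<^sub>m n"
    and D: "D \<in> carrier_mat n n" "diagonal_mat D" and UD: "A = U * D * mat_adjoint U"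
    using hermitian_unitarily_diagonalizable[OF A herm] .
  define d where "d k = D $$ (k, k)" for k
  have U': "mat_adjoint U \<in> carrier_mat n n" using U by simp
  have UU': "U * mat_adjoint U = 1\<^sub>m n"
    using mat_mult_left_right_inverse[OF U' U(1) U(2)] .
  \<comment> \<open>Similarity preserves the characteristic polynomial, so the diagonal of
    \<open>D\<close> lists the eigenvalues with multiplicity.\<close>
  have "similar_mat A D"
    by (rule similar_matI[of _ _ U "mat_adjoint U" n]) (use A U U' D UU' UD in auto)
  then have "char_poly A = char_poly D"
    by (rule char_poly_similar)
  also have "\<dots> = (\<Prod>a\<leftarrow>diag_mat D. [:- a, 1:])"
    by (rule char_poly_upper_triangular[OF D(1)])
      (use D in \<open>auto simp: diagonal_mat_def upper_triangular_def\<close>)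
  finally have cp: "char_poly A = (\<Prod>a\<leftarrow>diag_mat D. [:- a, 1:])" .
  have energy: "(\<Sum>ev\<in>spectrum A. real (order ev (char_poly A)) * cmod ev) = (\<Sum>k<n. cmod (d k))"
    using D unfolding sum_spectrum_order[OF A cp] diag_mat_def d_def
    by (simp add: o_def interv_sum_list_conv_sum_set_nat atLeast0LessThan)
  \<comment> \<open>Spectral expansion of \<open>A\<close> into rank-one terms from the columns of
    \<open>U\<close>.\<close>
  have entry: "A $$ (p, q) = (\<Sum>k<n. d k * (U $$ (p, k) * cnj (U $$ (q, k))))" if "p < n" "q < n" for p q
  proof -
    have "(U * D) $$ (p, k) = U $$ (p, k) * d k" if "k < n" for k
    proof -
      have "(U * D) $$ (p, k) = (\<Sum>j<n. U $$ (p, j) * D $$ (j, k))"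
        using \<open>p < n\<close> that U D by (simp add: scalar_prod_def atLeast0LessThan)
      also have "\<dots> = (\<Sum>j<n. if j = k then U $$ (p, k) * d k else 0)"
        using D that by (intro sum.cong) (auto simp: d_def diagonal_mat_def)
      finally show ?thesis using that by simp
    qed
    then show ?thesis
      using that U D by (subst UD) (simp add: scalar_prod_def atLeast0LessThan mult_ac)
  qed
  have unit: "(\<Sum>p<n. (cmod (U $$ (p, k)))\<^sup>2) = 1" if "k < n" for k
  proof -
    have "(mat_adjoint U * U) $$ (k, k) = (\<Sum>p<n. cnj (U $$ (p, k)) * U $$ (p, k))"
      using that U(1) by (simp add: scalar_prod_def atLeast0LessThan)
    also have "\<dots> = complex_of_real (\<Sum>p<n. (cmod (U $$ (p, k)))\<^sup>2)"
      by (simp add: mult.commute flip: complex_norm_square)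
    finally show ?thesis using that U(2) by (metis index_one_mat(1) of_real_eq_1_iff)
  qed
  have le1: "(\<Sum>(p, q)\<in>S. cmod (U $$ (p, k)) * cmod (U $$ (q, k))) \<le> 1" if k: "k < n" for k
  proof -
    let ?u = "\<lambda>p. (cmod (U $$ (p, k)))\<^sup>2"
    \<comment> \<open>By injectivity each row index occurs at most once, so this is a partial sum of
      the squared norm of column \<open>k\<close>.\<close>
    have fst: "(\<Sum>s\<in>S. ?u (fst s)) \<le> 1"
      unfolding unit[OF k, symmetric] sum.reindex[OF inj(1), of ?u, simplified o_def, symmetric]
      by (rule sum_mono2) (use S in auto)
    have snd: "(\<Sum>s\<in>S. ?u (snd s)) \<le> 1"
      unfolding unit[OF k, symmetric] sum.reindex[OF inj(2), of ?u, simplified o_def, symmetric]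
      by (rule sum_mono2) (use S in auto)
    \<comment> \<open>The inequality \<open>2ab \<le> a^2 + b^2\<close> splits each product into a
      row share and a column share.\<close>
    have "(\<Sum>(p, q)\<in>S. cmod (U $$ (p, k)) * cmod (U $$ (q, k))) \<le> (\<Sum>s\<in>S. (?u (fst s) + ?u (snd s)) / 2)"
    proof (rule sum_mono)
      fix s assume "s \<in> S"
      have "0 \<le> (cmod (U $$ (fst s, k)) - cmod (U $$ (snd s, k)))\<^sup>2" by simp
      then show "(case s of (p, q) \<Rightarrow> cmod (U $$ (p, k)) * cmod (U $$ (q, k))) \<le> (?u (fst s) + ?u (snd s)) / 2"
        by (simp add: case_prod_unfold power2_diff)
    qed
    also have "\<dots> \<le> 1"
      using fst snd by (simp add: sum.distrib flip: sum_divide_distrib)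
    finally show ?thesis .
  qed
  \<comment> \<open>The phase that turns each entry into its modulus. At a zero entry
    \<open>sgn\<close> gives 0, so \<open>z\<close> has modulus at most one everywhere.\<close>
  define z where "z s = cnj (sgn (A $$ s))" for s
  have "complex_of_real (\<Sum>(p, q)\<in>S. cmod (A $$ (p, q))) = (\<Sum>(p, q)\<in>S. z (p, q) * A $$ (p, q))"
  proof -
    have "cnj (sgn w) * w = complex_of_real (cmod w)" for w
      by (cases "w = 0") (simp_all add: sgn_eq complex_norm_square[symmetric] mult.commute power2_eq_square)
    then show ?thesis by (simp add: z_def case_prod_unfold)
  qed
  also have "\<dots> = (\<Sum>(p, q)\<in>S. \<Sum>k<n. d k * (z (p, q) * (U $$ (p, k) * cnj (U $$ (q, k)))))"
    using S by (intro sum.cong) (auto simp: entry sum_distrib_left mult_ac)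
  \<comment> \<open>Exchanging the sums isolates, for each eigenvalue, a form in its eigenvector
    that \<open>le1\<close> bounds.\<close>
  also have "\<dots> = (\<Sum>k<n. d k * (\<Sum>(p, q)\<in>S. z (p, q) * (U $$ (p, k) * cnj (U $$ (q, k)))))"
    by (simp add: case_prod_unfold sum.swap[of _ S] sum_distrib_left)
  also have "cmod \<dots> \<le> (\<Sum>k<n. cmod (d k) * 1)"
  proof (rule sum_norm_le)
    fix k assume "k \<in> {..<n}"
    then have k: "k < n" by simp
    have "cmod (\<Sum>(p, q)\<in>S. z (p, q) * (U $$ (p, k) * cnj (U $$ (q, k))))
      \<le> (\<Sum>(p, q)\<in>S. cmod (U $$ (p, k)) * cmod (U $$ (q, k)))"
      unfolding case_prod_unfold
      by (rule sum_norm_le) (auto simp: norm_mult z_def norm_sgn)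
    also have "\<dots> \<le> 1" by (rule le1[OF k])
    finally show "cmod (d k * (\<Sum>(p, q)\<in>S. z (p, q) * (U $$ (p, k) * cnj (U $$ (q, k))))) \<le> cmod (d k) * 1"
      unfolding norm_mult by (rule mult_left_mono) simp
  qed
  finally have "\<bar>\<Sum>(p, q)\<in>S. cmod (A $$ (p, q))\<bar> \<le> (\<Sum>k<n. cmod (d k))"
    unfolding norm_of_real mult_1_right .
  then show ?thesis unfolding energy by simp
qed

section \<open>From a maximum matching to the energy bound\<close>

theorem theorem4p8:
  fixes G :: "'a pair_pre_digraph"
    and \<phi> :: "'a \<times> 'a \<Rightarrow> complex"
    and vs :: "'a list"
  assumes "gain_graph G \<phi>"
    and "distinct vs" and "set vs = pverts G"
  shows "energy G \<phi> vs \<ge> 2 * real (matching_number G)"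
proof -
  interpret gain_graph G \<phi> by fact
  have "matching_number G \<in> card ` matchings G"
    unfolding matching_number_def using finite_matchings matchings_nonempty by (intro Max_in) auto
  then obtain M where M: "M \<subseteq> edges G" "disjoint M" and card_M: "card M = matching_number G"
    by (auto simp: matchings_def)
  let ?n = "length vs"
  define A where "A = adjacency_matrix G \<phi> vs"
  \<comment> \<open>Both orientations of every matching edge are included, as index pairs; this
    yields the factor 2.\<close>
  define S where "S = {(p, q). p < ?n \<and> q < ?n \<and> p \<noteq> q \<and> {vs ! p, vs ! q} \<in> M}"
  have eq: "p = q \<longleftrightarrow> vs ! p = vs ! q" if "p < ?n" "q < ?n" for p q
    using that \<open>distinct vs\<close> by (simp add: nth_eq_iff_index_eq)
  have same: "e = e'" if "x \<in> e" "x \<in> e'" "e \<in> M" "e' \<in> M" for x e e'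
    using M(2) that by (auto simp: disjoint_def)
  have pair: "\<exists>x y. e = {x, y} \<and> x \<noteq> y \<and> (x, y) \<in> parcs G" if "e \<in> M" for e
  proof -
    obtain x y where "e = {x, y}" "(x, y) \<in> parcs G"
      using M(1) \<open>e \<in> M\<close> unfolding edges_def by blast
    then show ?thesis using pair_no_loops[of "(x, y)"] by auto
  qed
  \<comment> \<open>Two positions in one row give matching edges sharing a vertex. Disjointness
    identifies the edges, and distinctness of \<open>vs\<close> then identifies the column
    indices.\<close>
  have "inj_on fst S"
  proof (rule inj_onI)
    fix s t assume "s \<in> S" "t \<in> S" "fst s = fst t"
    then show "s = t"
      using same[of "vs ! fst s" "{vs ! fst s, vs ! snd s}" "{vs ! fst s, vs ! snd t}"] eq
      by (auto simp: S_def doubleton_eq_iff)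
  qed
  have "inj_on snd S"
  proof (rule inj_onI)
    fix s t assume "s \<in> S" "t \<in> S" "snd s = snd t"
    then show "s = t"
      using same[of "vs ! snd s" "{vs ! fst s, vs ! snd s}" "{vs ! fst t, vs ! snd s}"] eq
      by (auto simp: S_def doubleton_eq_iff)
  qed
  \<comment> \<open>Each matched vertex is the first endpoint of an oriented matching edge, so
    \<open>card S\<close> is at least the number of matched vertices.\<close>
  have "\<Union>M \<subseteq> (\<lambda>s. vs ! fst s) ` S"
  proof
    fix x assume "x \<in> \<Union>M"
    then obtain e where e: "e \<in> M" "x \<in> e" by auto
    then obtain y where y: "e = {x, y}" "x \<noteq> y" "x \<in> pverts G" "y \<in> pverts G"
      using pair[OF e(1)] by (auto dest: in_arcsD1 in_arcsD2)
    then obtain p q where "p < ?n" "q < ?n" "vs ! p = x" "vs ! q = y"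
      using \<open>set vs = pverts G\<close> by (metis in_set_conv_nth)
    then have "(p, q) \<in> S" using y e by (auto simp: S_def)
    then show "x \<in> (\<lambda>s. vs ! fst s) ` S" using \<open>vs ! p = x\<close> by force
  qed
  moreover have fin: "finite S"
    by (rule finite_subset[of _ "{..<?n} \<times> {..<?n}"]) (auto simp: S_def)
  ultimately have "card (\<Union>M) \<le> card S"
    by (rule surj_card_le[rotated])
  moreover have "card (\<Union>M) = 2 * card M"
  proof -
    have "card e = 2 \<and> finite e" if "e \<in> M" for e
      using pair[OF that] by auto
    then show ?thesis
      using M(2) by (subst card_Union_disjoint) (auto simp: disjoint_def pairwise_def disjnt_def)
  qed
  ultimately have "2 * real (matching_number G) \<le> real (card S)"
    by (simp add: card_M)
  also have "\<dots> = (\<Sum>(p, q)\<in>S. cmod (A $$ (p, q)))"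
  proof -
    have "cmod (A $$ (p, q)) = 1" if "(p, q) \<in> S" for p q
    proof -
      have "{vs ! p, vs ! q} \<in> M" and pq: "p < ?n" "q < ?n" using that by (auto simp: S_def)
      \<comment> \<open>Membership in \<open>M\<close> supplies an arc in some orientation; symmetry
        of the arc set supplies the required one.\<close>
      then have "(vs ! p, vs ! q) \<in> parcs G"
        using pair[of "{vs ! p, vs ! q}"] pair_sym_arcs
        by (auto simp: doubleton_eq_iff symmetric_def dest: symD)
      then show ?thesis using pq gain_unit by (simp add: A_def adjacency_matrix_def)
    qed
    then have "(\<Sum>(p, q)\<in>S. cmod (A $$ (p, q))) = (\<Sum>s\<in>S. 1)"
      by (intro sum.cong) auto
    then show ?thesis by simp
  qed
  also have "\<dots> \<le> energy G \<phi> vs"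
    unfolding energy_def Let_def A_def[symmetric]
  proof (rule sum_le_energy[where n = ?n])
    show "mat_adjoint A = A"
      unfolding A_def by (rule adjacency_matrix_hermitian)
  qed (use \<open>inj_on fst S\<close> \<open>inj_on snd S\<close> in \<open>auto simp: A_def adjacency_matrix_def S_def\<close>)
  finally show ?thesis .
qed

end
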